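(* Let $S=\langle a\rangle$ be a monogenic semigroup. Then the independence number of $\Gamma(S)$ is $$\alpha(\Gamma(S))=\begin{cases}\infty & \text{if } S \text{ is infinite};\\ 1 & \text{if } S \text{ is finite and } m_a=1;\\ \left\lfloor \frac{m_a}{2}\right\rfloor+1 & \text{if } m_a>1 \text{ and } (i,r_a)>1 \text{ for all } i \text{ with } \left\lceil \frac{m_a}{2}\right\rceil\le i\le m_a-1;\\ \left\lfloor \frac{m_a}{2}\right\rfloor & \text{if } m_a>1 \text{ and } (i,r_a)=1 \text{ for some } i \text{ with } \left\lceil \frac{m_a}{2}\right\rceil\le i\le m_a-1.\end{cases}$$
   Context: For a subset $X$ of a semigroup $S$, $\langle X\rangle$ denotes the subsemigroup generated by $X$; a semigroup is monogenic if it equals $\langle a\rangle=\{a^k : k\in\mathbb{N}\}$ for some element $a$, where $\mathbb{N}=\{1,2,\dots\}$. The cyclic graph $\Gamma(S)$ is the simple undirected graph with vertex set $S$ in which two distinct vertices $x,y$ are adjacent if and only if $\langle x,y\rangle$ is a monogenic subsemigroup of $S$. When $\langle a\rangle$ is finite, the index $m_a$ of $a$ is the least $m\in\mathbb{N}$ such that $a^m=a^y$ for some $y\in\mathbb{N}$, $y\ne m$, and the period $r_a$ is the least $r\in\mathbb{N}$ with $a^{m_a+r}=a^{m_a}$; $m_a$ and $r_a$ are defined only in this case, so the last two cases concern finite $S$. $(u,v)$ denotes the greatest common divisor. *)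

theory Defs
  imports Complex_Main "HOL-Library.Extended_Nat" "HOL-Library.Ramsey"
begin

definition subsemigroup :: "'a::semigroup_mult set \<Rightarrow> bool" where
  "subsemigroup T \<longleftrightarrow> (\<forall>x\<in>T. \<forall>y\<in>T. x * y \<in> T)"

definition gen :: "'a::semigroup_mult set \<Rightarrow> 'a set" where
  "gen X = subsemigroup hull X"

definition monogenic :: "'a::semigroup_mult set \<Rightarrow> bool" where
  "monogenic T \<longleftrightarrow> (\<exists>a. T = gen {a})"

text \<open>A semigroup need not have a unit, so \<open>spow a k\<close> stands for \<open>a\<^sup>k\<close> only when \<open>k \<ge> 1\<close>;
  the value \<open>spow a 0 = a\<close> is junk, and all uses below require positive exponents.\<close>

definition spow :: "'a::semigroup_mult \<Rightarrow> nat \<Rightarrow> 'a" where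
  "spow a k = ((*) a ^^ (k - 1)) a"

lemma spow_1 [simp]: "spow a (Suc 0) = a"
  by (simp add: spow_def)

lemma spow_Suc: "1 \<le> k \<Longrightarrow> spow a (Suc k) = a * spow a k"
  by (cases k) (simp_all add: spow_def)

lemma spow_add:
  assumes "1 \<le> j" "1 \<le> k"
  shows "spow a (j + k) = spow a j * spow a k"
  using assms(1)
proof (induction j rule: dec_induct)
  case base
  show ?case using assms(2) by (simp add: spow_Suc)
next
  case (step n)
  then show ?case by (simp add: spow_Suc mult.assoc)
qed

lemma gen_singleton: "gen {a} = {spow a k | k. 1 \<le> k}"
proof
  have "subsemigroup {spow a k | k. 1 \<le> k}"
    unfolding subsemigroup_def
    by clarify (metis spow_add le_add1 le_trans)
  moreover have "a \<in> {spow a k | k. 1 \<le> k}"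
    by (metis (mono_tags, lifting) mem_Collect_eq One_nat_def le_refl spow_1)
  ultimately show "gen {a} \<subseteq> {spow a k | k. 1 \<le> k}"
    unfolding gen_def by (intro hull_minimal) auto
  have "spow a k \<in> gen {a}" if "1 \<le> k" for k
    using that
  proof (induction k rule: dec_induct)
    case base
    show ?case by (simp add: gen_def hull_inc)
  next
    case (step n)
    then show ?case
      by (simp add: spow_Suc) (auto simp: gen_def hull_def subsemigroup_def)
  qed
  then show "{spow a k | k. 1 \<le> k} \<subseteq> gen {a}" by auto
qed

text \<open>Meaningful only if \<open>gen {a}\<close> is finite; otherwise the \<open>LEAST\<close> ranges over no number.\<close>

definition index :: "'a::semigroup_mult \<Rightarrow> nat" where
  "index a = (LEAST m. 1 \<le> m \<and> (\<exists>y\<ge>1. y \<noteq> m \<and> spow a m = spow a y))"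

definition period :: "'a::semigroup_mult \<Rightarrow> nat" where
  "period a = (LEAST r. 1 \<le> r \<and> spow a (index a + r) = spow a (index a))"

text \<open>The edges of the cyclic graph with vertex set \<open>S\<close>, as two-element sets.\<close>

definition cyclic_graph_edges :: "'a::semigroup_mult set \<Rightarrow> 'a set set" where
  "cyclic_graph_edges S = {{x, y} | x y. x \<in> S \<and> y \<in> S \<and> x \<noteq> y \<and> monogenic (gen {x, y})}"

text \<open>Infinite independent sets have to be treated separately, as \<^const>\<open>card\<close> is 0 on them.\<close>

definition independence_number :: "'a set \<Rightarrow> 'a set set \<Rightarrow> enat" where
  "independence_number V E =
     (SUP A \<in> {A. A \<subseteq> V \<and> indep A E}. if finite A then enat (card A) else \<infinity>)"

end

theory Submission
  imports Defs "HOL-Number_Theory.Cong"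
begin

text \<open>
  Call \<open>i\<close> a \<^emph>\<open>unique exponent\<close> if no other power of \<open>a\<close> equals \<open>a\<^sup>i\<close>. In an infinite
  monogenic semigroup every \<open>i \<ge> 1\<close> is one; in a finite one with index \<open>m\<close> and period \<open>r\<close> these
  are the exponents below \<open>m\<close>, and the remaining elements \<open>a\<^sup>j\<close>, \<open>j \<ge> m\<close>, form a cyclic group
  \<open>K\<close> in which \<open>a\<^sup>j\<close> is determined by \<open>j\<close> modulo \<open>r\<close>.

  If \<open>i\<close> is a unique exponent and \<open>i \<le> j\<close>, all elements of \<open>\<langle>a\<^sup>i, a\<^sup>j\<rangle>\<close> are powers of
  \<open>a\<close> with exponent at least \<open>i\<close>. A single generator must have \<open>a\<^sup>i\<close> as a power, so its exponent is
  also at most \<open>i\<close>: the generator is \<open>a\<^sup>i\<close> itself. Hence \<open>a\<^sup>i\<close> and \<open>a\<^sup>j\<close> are adjacent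
  if and only if \<open>a\<^sup>j\<close> is a power of \<open>a\<^sup>i\<close> (\<open>monogenic_pair_unique_exponent_iff\<close>). This settles
  every pair outside \<open>K \<times> K\<close>: two unique exponents are adjacent exactly when one divides the other; and
  \<open>a\<^sup>i\<close> with \<open>i < m\<close> is adjacent to all of \<open>K\<close> if \<open>i\<close> is coprime to \<open>r\<close>, but not to a generator
  of \<open>K\<close> congruent to \<open>1\<close> modulo \<open>r\<close> otherwise. Inside \<open>K\<close> any two elements are adjacent, as
  subgroups of cyclic groups are cyclic (\<open>kernel_pair_monogenic\<close>).

  An independent set therefore consists of a divisibility antichain in \<open>{1..<m}\<close> and at most one element of
  \<open>K\<close>. Numbers with the same odd part are comparable, so such an antichain has at most as many elements as
  there are odd numbers below \<open>m\<close>, which is \<open>\<lfloor>m/2\<rfloor>\<close>; the upper half of the interval attains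
  this bound. If no number in the upper half is coprime to \<open>r\<close>, a generator of \<open>K\<close> can be added to it.
  If some \<open>n\<close> in the upper half is coprime to \<open>r\<close>, then an antichain of maximum size contains a
  number with the odd part of \<open>n\<close>; it divides \<open>n\<close>
  (\<open>maximum_antichain_contains_divisor\<close>), so it is coprime to \<open>r\<close> too and
  excludes every element of \<open>K\<close>. In the infinite case the intervals \<open>{n+1..2n}\<close> give arbitrarily large
  independent sets.
\<close>

section \<open>Generated subsemigroups\<close>

lemma subsemigroup_gen: "subsemigroup (gen X)"
  unfolding gen_def hull_def subsemigroup_def by blast

lemma gen_superset: "X \<subseteq> gen X"
  unfolding gen_def by (rule hull_subset)

lemma gen_least: "X \<subseteq> T \<Longrightarrow> subsemigroup T \<Longrightarrow> gen X \<subseteq> T"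
  unfolding gen_def by (rule hull_minimal)

lemma gen_mult_closed: "x \<in> gen X \<Longrightarrow> y \<in> gen X \<Longrightarrow> x * y \<in> gen X"
  using subsemigroup_gen unfolding subsemigroup_def by blast

lemma spow_in_gen:
  assumes "x \<in> gen X" "1 \<le> k"
  shows "spow x k \<in> gen X"
proof -
  have "gen {x} \<subseteq> gen X"
    using assms(1) by (intro gen_least subsemigroup_gen) simp
  then show ?thesis
    using assms(2) by (auto simp: gen_singleton)
qed

lemma spow_spow:
  assumes "1 \<le> i" "1 \<le> t"
  shows "spow (spow a i) t = spow a (i * t)"
  using assms(2)
proof (induction t rule: dec_induct)
  case base
  show ?case by simp
next
  case (step t)
  then show ?case
    using assms(1) spow_add[of i "i * t" a] by (simp add: spow_Suc)
qed

lemma gen_spow: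
  assumes "1 \<le> i"
  shows "gen {spow a i} = {spow a (i * t) | t. 1 \<le> t}"
  unfolding gen_singleton using spow_spow[OF assms] by metis

lemma monogenic_gen_pair_iff:
  "monogenic (gen {x, y}) \<longleftrightarrow> (\<exists>z \<in> gen {x, y}. x \<in> gen {z} \<and> y \<in> gen {z})"
proof
  assume "monogenic (gen {x, y})"
  then obtain z where "gen {x, y} = gen {z}"
    unfolding monogenic_def by blast
  then show "\<exists>z \<in> gen {x, y}. x \<in> gen {z} \<and> y \<in> gen {z}"
    using gen_superset[of "{x, y}"] gen_superset[of "{z}"] by auto
next
  assume "\<exists>z \<in> gen {x, y}. x \<in> gen {z} \<and> y \<in> gen {z}"
  then obtain z where "z \<in> gen {x, y}" "x \<in> gen {z}" "y \<in> gen {z}" by blast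
  then have "gen {x, y} = gen {z}"
    by (intro subset_antisym gen_least subsemigroup_gen) auto
  then show "monogenic (gen {x, y})"
    unfolding monogenic_def by blast
qed

section \<open>Exponents of unique powers\<close>

definition unique_exponent :: "'a::semigroup_mult \<Rightarrow> nat \<Rightarrow> bool" where
  "unique_exponent a i \<longleftrightarrow> 1 \<le> i \<and> (\<forall>k\<ge>1. spow a k = spow a i \<longrightarrow> k = i)"

text \<open>
  The only candidate for a generator is \<open>a\<^sup>i\<close>: exponents in the generated subsemigroup are at least
  \<open>i\<close>, and the exponent of a generator divides \<open>i\<close> because \<open>a\<^sup>i\<close> has no other
  representation.
\<close>

lemma monogenic_pair_unique_exponent_iff:
  assumes i: "unique_exponent a i" and ij: "i \<le> j"
  shows "monogenic (gen {spow a i, spow a j}) \<longleftrightarrow> spow a j \<in> gen {spow a i}"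
proof
  let ?x = "spow a i" and ?y = "spow a j"
  have i1: "1 \<le> i" using i by (simp add: unique_exponent_def)
  assume "monogenic (gen {?x, ?y})"
  then obtain z where z: "z \<in> gen {?x, ?y}" "?x \<in> gen {z}" "?y \<in> gen {z}"
    unfolding monogenic_gen_pair_iff by blast
  have "subsemigroup {spow a k | k. i \<le> k}"
    unfolding subsemigroup_def
  proof clarify
    fix k l assume "i \<le> k" "i \<le> l"
    then have "spow a k * spow a l = spow a (k + l)" "i \<le> k + l"
      using spow_add[of k l a] i1 by auto
    then show "\<exists>n. spow a k * spow a l = spow a n \<and> i \<le> n" by blast
  qed
  then have "gen {?x, ?y} \<subseteq> {spow a k | k. i \<le> k}"
    using ij by (intro gen_least) auto
  then obtain k where k: "z = spow a k" "i \<le> k"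
    using z(1) by blast
  obtain t where t: "1 \<le> t" "?x = spow z t"
    using z(2) unfolding gen_singleton by blast
  have "spow a (k * t) = ?x"
    using spow_spow[of k t a] t k i1 by simp
  moreover have "1 \<le> k * t" using k(2) t(1) i1 by (simp add: Suc_le_eq)
  ultimately have "k * t = i"
    using i unfolding unique_exponent_def by blast
  then have "k \<le> i" using t(1) i1 by auto
  then have "z = ?x" using k by simp
  then show "?y \<in> gen {?x}" using z(3) by simp
next
  assume "spow a j \<in> gen {spow a i}"
  then show "monogenic (gen {spow a i, spow a j})"
    unfolding monogenic_gen_pair_iff using gen_superset by (metis insert_subset)
qed

lemma monogenic_pair_iff_dvd:
  assumes i: "unique_exponent a i" and j: "unique_exponent a j" and "i \<le> j"
  shows "monogenic (gen {spow a i, spow a j}) \<longleftrightarrow> i dvd j"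
proof -
  have ij: "1 \<le> i" "1 \<le> j" using i j by (auto simp: unique_exponent_def)
  have "spow a j \<in> gen {spow a i} \<longleftrightarrow> (\<exists>t\<ge>1. spow a (i * t) = spow a j)"
    unfolding gen_spow[OF ij(1)] mem_Collect_eq by metis
  also have "\<dots> \<longleftrightarrow> (\<exists>t\<ge>1. i * t = j)"
  proof
    assume "\<exists>t\<ge>1. spow a (i * t) = spow a j"
    then obtain t where t: "1 \<le> t" "spow a (i * t) = spow a j" by blast
    then have "1 \<le> i * t" using ij by (simp add: Suc_le_eq)
    then show "\<exists>t\<ge>1. i * t = j"
      using j t unfolding unique_exponent_def by blast
  qed auto
  also have "\<dots> \<longleftrightarrow> i dvd j"
  proof
    assume "i dvd j"
    then obtain t where "j = i * t" by blast
    moreover from this have "1 \<le> t" using ij(2) by (cases t) auto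
    ultimately show "\<exists>t\<ge>1. i * t = j" by blast
  qed auto
  finally show ?thesis
    using monogenic_pair_unique_exponent_iff[OF i \<open>i \<le> j\<close>] by simp
qed

lemma unique_exponent_inj_on:
  assumes "\<And>i. i \<in> I \<Longrightarrow> unique_exponent a i"
  shows "inj_on (spow a) I"
  using assms unfolding inj_on_def unique_exponent_def by metis

section \<open>Index and period\<close>

text \<open>
  A coincidence \<open>a\<^sup>u = a\<^sup>v\<close> with \<open>u < v\<close> lets any exponent from \<open>v\<close> on be lowered by
  \<open>v - u\<close>, so that finitely many powers would remain.
\<close>

lemma unique_exponent_if_infinite:
  assumes "infinite (gen {a})" "1 \<le> i"
  shows "unique_exponent a i"
proof (rule ccontr)
  assume "\<not> unique_exponent a i"
  then obtain k where "1 \<le> k" "k \<noteq> i" "spow a k = spow a i"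
    using assms(2) unfolding unique_exponent_def by blast
  then obtain u v where uv: "1 \<le> u" "u < v" "spow a u = spow a v"
    using assms(2) by (metis nat_neq_iff)
  have "spow a n \<in> spow a ` {1..<v}" if "1 \<le> n" for n
    using that
  proof (induction n rule: less_induct)
    case (less n)
    show ?case
    proof (cases "n < v")
      case True
      then show ?thesis using less.prems by auto
    next
      case False
      have "spow a n = spow a (n - v + u)"
      proof (cases "n = v")
        case False
        then show ?thesis
          using spow_add[of "n - v" v a] spow_add[of "n - v" u a] uv \<open>\<not> n < v\<close> by simp
      qed (use uv in simp)
      then show ?thesis using less.IH[of "n - v + u"] uv False by simp
    qed
  qed
  then have "gen {a} \<subseteq> spow a ` {1..<v}" by (auto simp: gen_singleton)
  then show False using assms(1) finite_surj[of "{1..<v}"] by blast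
qed

lemma spow_shift:
  assumes "1 \<le> u" "1 \<le> v" "spow a u = spow a v"
  shows "spow a (u + n) = spow a (v + n)"
proof (cases "n = 0")
  case False
  then show ?thesis using assms spow_add[of u n a] spow_add[of v n a] by simp
qed (use assms in simp)

lemma index_facts:
  assumes "finite (gen {a})"
  shows index_ge_1: "1 \<le> index a"
    and ex_power_eq_index: "\<exists>y>index a. spow a (index a) = spow a y"
    and unique_exponent_if_less_index: "1 \<le> i \<Longrightarrow> i < index a \<Longrightarrow> unique_exponent a i"
proof -
  let ?P = "\<lambda>m. 1 \<le> m \<and> (\<exists>y\<ge>1. y \<noteq> m \<and> spow a m = spow a y)"
  have "\<not> inj_on (spow a) {1..}"
  proof
    assume "inj_on (spow a) {1..}"
    then have "infinite (spow a ` {1..})"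
      using finite_imageD infinite_Ici by blast
    moreover have "spow a ` {1..} = gen {a}" by (auto simp: gen_singleton)
    ultimately show False using assms by simp
  qed
  then have "\<exists>m. ?P m" unfolding inj_on_def by (metis atLeast_iff)
  then have *: "?P (index a)" unfolding index_def by (rule LeastI_ex)
  have least: "index a \<le> m" if "?P m" for m
    unfolding index_def using that by (rule Least_le)
  show "1 \<le> index a" using * by blast
  obtain y where y: "1 \<le> y" "y \<noteq> index a" "spow a (index a) = spow a y"
    using * by blast
  have "index a \<le> y" using y * by (intro least) auto
  then show "\<exists>y>index a. spow a (index a) = spow a y"
    using y by (intro exI[of _ y]) auto
  show "unique_exponent a i" if "1 \<le> i" "i < index a"
    unfolding unique_exponent_def using least[of i] that by (metis not_le)
qed

lemma period_facts:
  assumes "finite (gen {a})"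
  shows period_ge_1: "1 \<le> period a"
    and spow_index_plus_period: "spow a (index a + period a) = spow a (index a)"
    and period_least: "\<And>r. 1 \<le> r \<Longrightarrow> spow a (index a + r) = spow a (index a) \<Longrightarrow> period a \<le> r"
proof -
  let ?P = "\<lambda>r. 1 \<le> r \<and> spow a (index a + r) = spow a (index a)"
  obtain y where "y > index a" "spow a (index a) = spow a y"
    using ex_power_eq_index[OF assms] by blast
  then have "?P (y - index a)" by simp
  then have "?P (period a)" unfolding period_def by (rule LeastI)
  then show "1 \<le> period a" "spow a (index a + period a) = spow a (index a)" by auto
  show "period a \<le> r" if "1 \<le> r" "spow a (index a + r) = spow a (index a)" for r
    unfolding period_def using that by (intro Least_le) simp
qed

text \<open>
  Let \<open>m\<close> be the index and \<open>r\<close> the period. If two exponents \<open>m + s\<close> and \<open>m + t\<close> with \<open>s < t < r\<close> gave the same power, multiplying by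
  \<open>a\<^bsup>r - t\<^esup>\<close> would turn the right-hand side into \<open>a\<^bsup>m + r\<^esup> = a\<^sup>m\<close> and
  make \<open>s + (r - t) < r\<close> a smaller period.
\<close>

lemma spow_eq_iff_cong:
  assumes fin: "finite (gen {a})" and "index a \<le> u" "index a \<le> v"
  shows "spow a u = spow a v \<longleftrightarrow> [u = v] (mod period a)"
proof -
  define m r where "m = index a" and "r = period a"
  have m: "1 \<le> m" using index_ge_1[OF fin] by (simp add: m_def)
  have r: "1 \<le> r" using period_ge_1[OF fin] by (simp add: r_def)
  have add_r: "spow a (m + n + r) = spow a (m + n)" for n
    using spow_shift[of "m + r" m a n] spow_index_plus_period[OF fin] m
    by (simp add: m_def r_def ac_simps)
  have add_mult: "spow a (m + n + r * q) = spow a (m + n)" for n q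
  proof (induction q)
    case (Suc q)
    then show ?case using add_r[of "n + r * q"] by (simp add: ac_simps)
  qed simp
  have reduce: "spow a (m + n) = spow a (m + n mod r)" for n
    using add_mult[of "n mod r" "n div r"] by (simp add: add.assoc)
  have inj: False if "s < t" "t < r" "spow a (m + s) = spow a (m + t)" for s t
  proof -
    have "spow a (m + s + (r - t)) = spow a (m + t + (r - t))"
      using that m by (intro spow_shift) auto
    then have "spow a (m + (s + (r - t))) = spow a m"
      using that spow_index_plus_period[OF fin] by (simp add: m_def r_def ac_simps)
    moreover have "1 \<le> s + (r - t)" "s + (r - t) < r" using that by auto
    ultimately show False
      using period_least[OF fin, of "s + (r - t)"] by (simp add: m_def r_def)
  qed
  obtain u' v' where u': "u = m + u'" and v': "v = m + v'"
    using assms(2,3) by (metis le_Suc_ex m_def)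
  have "spow a u = spow a v \<longleftrightarrow> spow a (m + u' mod r) = spow a (m + v' mod r)"
    using reduce[of u'] reduce[of v'] by (simp add: u' v')
  also have "\<dots> \<longleftrightarrow> u' mod r = v' mod r"
    using inj[of "u' mod r" "v' mod r"] inj[of "v' mod r" "u' mod r"] r
    by (metis Suc_le_eq One_nat_def linorder_neqE_nat mod_less_divisor)
  also have "\<dots> \<longleftrightarrow> [u = v] (mod r)"
    unfolding u' v' by (simp add: cong_def [symmetric] cong_add_lcancel_nat)
  finally show ?thesis by (simp add: r_def)
qed

section \<open>The cyclic group at the end of a finite monogenic semigroup\<close>

text \<open>The minimal ideal of \<open>\<langle>a\<rangle>\<close>, for finite \<open>\<langle>a\<rangle>\<close>.\<close>

definition kernel :: "'a::semigroup_mult \<Rightarrow> 'a set" where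
  "kernel a = spow a ` {index a..}"

text \<open>
  In the group, \<open>a\<^sup>d\<close> with \<open>d = gcd j k\<close> would generate the same subgroup as \<open>a\<^sup>j\<close> and
  \<open>a\<^sup>k\<close>. As \<open>d\<close> may lie below the index, the generator used is \<open>a\<^sup>n\<close> for an exponent \<open>n\<close>
  congruent to \<open>d\<close> modulo the period that is at least the index and a combination of \<open>j\<close> and \<open>k\<close>
  with positive coefficients.
\<close>

lemma kernel_pair_monogenic:
  assumes fin: "finite (gen {a})" and "x \<in> kernel a" "y \<in> kernel a"
  shows "monogenic (gen {x, y})"
proof -
  define r where "r = period a"
  obtain j k where j: "index a \<le> j" "x = spow a j" and k: "index a \<le> k" "y = spow a k"
    using assms by (auto simp: kernel_def)
  have m: "1 \<le> index a" using index_ge_1[OF fin] .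
  have r: "1 \<le> r" using period_ge_1[OF fin] by (simp add: r_def)
  define d where "d = gcd j k"
  obtain p q where "j * p = k * q + d"
    using bezout_nat[of j k] m j by (auto simp: d_def)
  \<comment> \<open>Modulo \<open>r\<close>, the coefficient \<open>- q\<close> of \<open>k\<close> equals \<open>q * (r - 1)\<close>; adding \<open>r\<close> makes both
    coefficients positive.\<close>
  define s t where "s = p + r" and "t = q * (r - 1) + r"
  define n where "n = j * s + k * t"
  have "n = d + r * (k * q + j + k)"
  proof -
    obtain r' where r': "r = Suc r'" using r by (cases r) auto
    have "n = j * p + j * r + k * q * r' + k * r"
      by (simp add: n_def s_def t_def r' algebra_simps)
    also have "\<dots> = d + r * (k * q + j + k)"
      using \<open>j * p = k * q + d\<close> by (simp add: r' algebra_simps)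
    finally show ?thesis .
  qed
  then have n_cong: "[n = d] (mod r)" by (simp add: cong_def)
  have st: "1 \<le> s" "1 \<le> t" using r by (auto simp: s_def t_def)
  have n_ge: "index a \<le> n"
    using j(1) st(1) unfolding n_def by (metis le_add1 le_trans mult_le_mono mult_1_right)
  have "spow a n = spow x s * spow y t"
    using spow_add[of "j * s" "k * t" a] j k m st by (simp add: n_def spow_spow Suc_le_eq)
  also have "\<dots> \<in> gen {x, y}"
    using st gen_superset[of "{x, y}"] by (intro gen_mult_closed spow_in_gen) auto
  finally have "spow a n \<in> gen {x, y}" .
  moreover have "spow a l \<in> gen {spow a n}" if "d dvd l" "index a \<le> l" for l
  proof -
    obtain c where c: "l = d * c" using \<open>d dvd l\<close> by blast
    have c1: "1 \<le> c" using c that m by (cases c) auto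
    have "[n * c = l] (mod r)" unfolding c using n_cong by (rule cong_scalar_right)
    moreover have "index a \<le> n * c"
      using n_ge c1 by (metis le_trans mult_le_mono mult_1_right)
    ultimately have "spow a l = spow a (n * c)"
      using spow_eq_iff_cong[OF fin] that by (simp add: r_def cong_sym_eq)
    also have "\<dots> = spow (spow a n) c"
      using n_ge m c1 by (intro spow_spow [symmetric]) auto
    finally show ?thesis using c1 by (auto simp: gen_singleton)
  qed
  ultimately show ?thesis
    unfolding monogenic_gen_pair_iff using j k by (auto simp: d_def)
qed

text \<open>
  Modulo the period, \<open>i\<close> is invertible, so some multiple of \<open>i\<close> is congruent to the exponent of \<open>y\<close>.
\<close>

lemma in_gen_if_coprime:
  assumes fin: "finite (gen {a})" and i: "1 \<le> i" "coprime i (period a)" and "y \<in> kernel a"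
  shows "y \<in> gen {spow a i}"
proof -
  obtain j where j: "index a \<le> j" "y = spow a j" using assms by (auto simp: kernel_def)
  have r: "1 \<le> period a" using period_ge_1[OF fin] .
  obtain c where c: "[i * c = 1] (mod period a)"
    using cong_solve_coprime_nat[OF i(2)] by auto
  \<comment> \<open>The second summand vanishes modulo the period and lifts the exponent \<open>i * t\<close> above the index.\<close>
  define t where "t = c * j + period a * index a"
  have "[i * t = j] (mod period a)"
  proof -
    have "[i * c * j + period a * (i * index a) = 1 * j + 0] (mod period a)"
      using c by (intro cong_add cong_mult cong_refl) (auto simp: cong_0_iff)
    then show ?thesis by (simp add: t_def algebra_simps)
  qed
  have t: "index a \<le> t" using r by (simp add: t_def trans_le_add2)
  then have "1 \<le> t" using index_ge_1[OF fin] by simp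
  have "index a \<le> i * t" using t i by (metis le_trans mult_le_mono mult_1)
  then have "y = spow a (i * t)"
    using spow_eq_iff_cong[OF fin, of j "i * t"] j \<open>[i * t = j] (mod period a)\<close>
    by (simp add: cong_sym)
  then show ?thesis
    unfolding gen_spow[OF i(1)] using \<open>1 \<le> t\<close> by blast
qed

text \<open>
  Conversely, if a power of \<open>a\<^sup>i\<close> is the generator of the group with exponent \<open>1\<close> modulo the period,
  then \<open>i\<close> is invertible modulo the period.
\<close>

lemma coprime_if_generator_in_gen:
  assumes fin: "finite (gen {a})" and i: "1 \<le> i"
    and j: "index a \<le> j" "[j = 1] (mod period a)" and gen: "spow a j \<in> gen {spow a i}"
  shows "coprime i (period a)"
proof -
  obtain t where t: "1 \<le> t" "spow a j = spow a (i * t)"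
    using gen unfolding gen_spow[OF i] by blast
  have it: "1 \<le> i * t" using i t by (simp add: Suc_le_eq)
  have "1 \<le> j" using j index_ge_1[OF fin] by simp
  have "index a \<le> i * t"
  proof (rule ccontr)
    assume "\<not> index a \<le> i * t"
    then have "unique_exponent a (i * t)"
      using unique_exponent_if_less_index[OF fin it] by simp
    then have "j = i * t" using t \<open>1 \<le> j\<close> unfolding unique_exponent_def by blast
    then show False using j \<open>\<not> index a \<le> i * t\<close> by simp
  qed
  then have "[j = i * t] (mod period a)"
    using spow_eq_iff_cong[OF fin] j t by simp
  then have "[i * t = 1] (mod period a)"
    using j(2) by (metis cong_sym cong_trans)
  then have "\<exists>x. [i * x = 1] (mod period a)" by blast
  then show ?thesis using coprime_iff_invertible_nat by simp
qed

section \<open>Antichains of the divisibility order\<close>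

definition odd_part :: "nat \<Rightarrow> nat" where
  "odd_part n = n div 2 ^ multiplicity 2 n"

lemma odd_part_decomposition: "n = 2 ^ multiplicity 2 n * odd_part n"
  by (simp add: odd_part_def multiplicity_dvd)

lemma odd_odd_part:
  assumes "n \<noteq> 0"
  shows "odd (odd_part n)"
  using multiplicity_decompose[of n 2] assms by (simp add: odd_part_def)

lemma dvd_if_odd_part_eq_multiplicity_le:
  assumes "odd_part i = odd_part j" "multiplicity 2 i \<le> multiplicity 2 j"
  shows "i dvd j"
proof -
  have "2 ^ multiplicity 2 i * odd_part i dvd 2 ^ multiplicity 2 j * odd_part j"
    unfolding assms(1) using assms(2) by (intro mult_dvd_mono le_imp_power_dvd) auto
  then show ?thesis
    by (simp only: odd_part_decomposition [symmetric])
qed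

lemma dvd_if_odd_part_eq:
  assumes "odd_part i = odd_part j"
  shows "i dvd j \<or> j dvd i"
  using dvd_if_odd_part_eq_multiplicity_le[of i j] dvd_if_odd_part_eq_multiplicity_le[of j i]
    assms by (metis nat_le_linear)

text \<open>
  Among the numbers with a given odd part, each is at least twice the next smaller one.
\<close>

lemma dvd_if_odd_part_eq_less:
  assumes "odd_part i = odd_part j" "i < 2 * j"
  shows "i dvd j"
proof (rule dvd_if_odd_part_eq_multiplicity_le[OF assms(1)], rule ccontr)
  assume "\<not> multiplicity 2 i \<le> multiplicity 2 j"
  then have "2 ^ Suc (multiplicity 2 j) * odd_part j \<le> 2 ^ multiplicity 2 i * odd_part i"
    using assms(1) by (intro mult_le_mono power_increasing) auto
  then have "2 * j \<le> i"
    unfolding power_Suc mult.assoc by (simp only: odd_part_decomposition [symmetric])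
  then show False using assms(2) by simp
qed

lemma card_odd_less: "card {q::nat. odd q \<and> q < m} = m div 2"
proof -
  have "{q. odd q \<and> q < m} = (\<lambda>k. 2 * k + 1) ` {..<m div 2}"
  proof
    show "{q. odd q \<and> q < m} \<subseteq> (\<lambda>k. 2 * k + 1) ` {..<m div 2}"
    proof clarify
      fix q assume "odd q" "q < m"
      then obtain k where "q = 2 * k + 1" by (blast elim: oddE)
      then show "q \<in> (\<lambda>k. 2 * k + 1) ` {..<m div 2}" using \<open>q < m\<close> by auto
    qed
  qed auto
  then show ?thesis by (simp add: card_image inj_on_def)
qed

text \<open>
  Numbers with a common odd part form a chain, so an antichain contains at most one for each odd number
  below \<open>m\<close>.
\<close>

lemma odd_part_antichain:
  assumes anti: "\<And>i j. i \<in> I \<Longrightarrow> j \<in> I \<Longrightarrow> i dvd j \<Longrightarrow> i = j" and I: "I \<subseteq> {1..<m}"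
  shows inj_on_odd_part: "inj_on odd_part I"
    and odd_part_image: "odd_part ` I \<subseteq> {q. odd q \<and> q < m}"
    and card_antichain_le: "card I \<le> m div 2"
proof -
  show inj: "inj_on odd_part I"
  proof (rule inj_onI)
    fix i j assume "i \<in> I" "j \<in> I" "odd_part i = odd_part j"
    then show "i = j" using dvd_if_odd_part_eq[of i j] anti[of i j] anti[of j i] by blast
  qed
  show im: "odd_part ` I \<subseteq> {q. odd q \<and> q < m}"
  proof (intro image_subsetI CollectI conjI)
    fix i assume "i \<in> I"
    then have "i \<noteq> 0" "i < m" using I by auto
    moreover have "odd_part i \<le> i" by (simp add: odd_part_def)
    ultimately show "odd (odd_part i)" "odd_part i < m" by (simp_all add: odd_odd_part)
  qed
  show "card I \<le> m div 2"
    using card_inj_on_le[OF inj im] card_odd_less[of m] by simp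
qed

text \<open>
  An antichain of maximum size meets the chain of every odd number below \<open>m\<close>. A number \<open>n\<close> in the upper half is
  the top of its chain below \<open>m\<close>, hence a multiple of the member that represents this chain.
\<close>

lemma maximum_antichain_contains_divisor:
  assumes anti: "\<And>i j. i \<in> I \<Longrightarrow> j \<in> I \<Longrightarrow> i dvd j \<Longrightarrow> i = j" and I: "I \<subseteq> {1..<m}"
    and card: "card I = m div 2" and n: "m \<le> 2 * n" "n < m"
  shows "\<exists>i\<in>I. i dvd n"
proof -
  have "odd_part ` I = {q. odd q \<and> q < m}"
    using odd_part_image[OF anti I] card card_image[OF inj_on_odd_part[OF anti I]]
    by (intro card_subset_eq) (simp_all add: card_odd_less)
  moreover have "odd_part n \<le> n" by (simp add: odd_part_def)
  then have "odd_part n \<in> {q. odd q \<and> q < m}" using n odd_odd_part[of n] by simp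
  ultimately have "odd_part n \<in> odd_part ` I" by simp
  then obtain i where i: "i \<in> I" "odd_part i = odd_part n" by (elim imageE) simp
  then have "i dvd n" using I n by (intro dvd_if_odd_part_eq_less) auto
  then show ?thesis using i by blast
qed

section \<open>Independent sets\<close>

lemma indep_cyclic_graph_iff:
  assumes "A \<subseteq> S"
  shows "indep A (cyclic_graph_edges S) \<longleftrightarrow>
    (\<forall>x\<in>A. \<forall>y\<in>A. x \<noteq> y \<longrightarrow> \<not> monogenic (gen {x, y}))"
proof -
  have "{x, y} \<in> cyclic_graph_edges S \<longleftrightarrow> monogenic (gen {x, y})"
    if "x \<in> A" "y \<in> A" "x \<noteq> y" for x y
  proof
    assume "{x, y} \<in> cyclic_graph_edges S"
    then obtain u v where "{x, y} = {u, v}" "monogenic (gen {u, v})"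
      unfolding cyclic_graph_edges_def by blast
    then show "monogenic (gen {x, y})" by simp
  next
    assume "monogenic (gen {x, y})"
    then show "{x, y} \<in> cyclic_graph_edges S"
      using that assms unfolding cyclic_graph_edges_def by blast
  qed
  then show ?thesis unfolding indep_def by blast
qed

lemma card_le_independence_number:
  assumes "A \<subseteq> V" "indep A E" "finite A"
  shows "enat (card A) \<le> independence_number V E"
proof -
  have "(if finite A then enat (card A) else \<infinity>) \<le> independence_number V E"
    unfolding independence_number_def using assms by (intro SUP_upper) auto
  then show ?thesis using assms by simp
qed

lemma independence_number_eq:
  assumes "finite V" "A \<subseteq> V" "indep A E" "card A = n"
    and "\<And>B. B \<subseteq> V \<Longrightarrow> indep B E \<Longrightarrow> card B \<le> n"
  shows "independence_number V E = enat n"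
proof (rule antisym)
  show "independence_number V E \<le> enat n"
    unfolding independence_number_def
    using assms(1,5) by (intro SUP_least) (auto dest: finite_subset)
  show "enat n \<le> independence_number V E"
    using card_le_independence_number[of A V E] assms finite_subset by blast
qed

text \<open>
  A proper multiple is at least twice as large, so no element of \<open>I\<close> properly divides another.
\<close>

lemma indep_spow_image:
  assumes u: "\<And>i. i \<in> I \<Longrightarrow> unique_exponent a i" and lt: "\<And>i j. i \<in> I \<Longrightarrow> j \<in> I \<Longrightarrow> j < 2 * i"
  shows "indep (spow a ` I) (cyclic_graph_edges (gen {a}))"
proof -
  have sub: "spow a ` I \<subseteq> gen {a}"
    using u by (auto simp: gen_singleton unique_exponent_def)
  have not_mono: "\<not> monogenic (gen {spow a i, spow a j})" if "i \<in> I" "j \<in> I" "i < j" for i j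
  proof
    assume "monogenic (gen {spow a i, spow a j})"
    then have "i dvd j" using monogenic_pair_iff_dvd u that by (metis less_imp_le)
    then obtain c where c: "j = i * c" by blast
    then have "c \<noteq> 0" "c \<noteq> 1" using that by auto
    then have "2 \<le> c" by simp
    then have "2 * i \<le> j" using c by simp
    then show False using lt[OF that(1,2)] by simp
  qed
  show ?thesis
    unfolding indep_cyclic_graph_iff[OF sub]
  proof (intro ballI impI)
    fix x y assume "x \<in> spow a ` I" "y \<in> spow a ` I" "x \<noteq> y"
    then obtain i j where ij: "i \<in> I" "j \<in> I" "x = spow a i" "y = spow a j" by blast
    then consider "i < j" | "j < i" using \<open>x \<noteq> y\<close> by (metis nat_neq_iff)
    then show "\<not> monogenic (gen {x, y})"
      using not_mono ij by cases (simp, metis insert_commute)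
  qed
qed

section \<open>The independence number\<close>

lemma independence_number_infinite:
  assumes "infinite (gen {a})"
  shows "independence_number (gen {a}) (cyclic_graph_edges (gen {a})) = \<infinity>"
proof -
  have "enat n \<le> independence_number (gen {a}) (cyclic_graph_edges (gen {a}))" for n
  proof -
    let ?I = "{n + 1..2 * n}"
    have u: "unique_exponent a i" if "i \<in> ?I" for i
      using unique_exponent_if_infinite[OF assms] that by simp
    have "indep (spow a ` ?I) (cyclic_graph_edges (gen {a}))"
      using u by (rule indep_spow_image) auto
    moreover have "spow a ` ?I \<subseteq> gen {a}"
      by (auto simp: gen_singleton)
    moreover have "card (spow a ` ?I) = n"
      using unique_exponent_inj_on[of ?I a] u by (simp add: card_image)
    ultimately show ?thesis
      using card_le_independence_number by fastforce
  qed
  then show ?thesis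
    by (metis Suc_n_not_le_n enat_ord_simps(1) not_infinity_eq)
qed

text \<open>
  The structure behind both upper bounds: apart from an antichain of exponents below the index, an independent
  set has at most one element, and such an element keeps all these exponents from being coprime to the period.
\<close>

lemma independent_set_split:
  assumes fin: "finite (gen {a})" and A: "A \<subseteq> gen {a}" "indep A (cyclic_graph_edges (gen {a}))"
  defines "I \<equiv> {i \<in> {1..<index a}. spow a i \<in> A}"
  shows "card A = card I + card (A \<inter> kernel a)" (is ?split)
    and "\<And>i j. i \<in> I \<Longrightarrow> j \<in> I \<Longrightarrow> i dvd j \<Longrightarrow> i = j" (is "\<And>i j. PROP ?anti i j")
    and "card (A \<inter> kernel a) \<le> 1" (is ?kernel)
    and "\<And>i. A \<inter> kernel a \<noteq> {} \<Longrightarrow> i \<in> I \<Longrightarrow> \<not> coprime i (period a)" (is "\<And>i. PROP ?cop i")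
proof -
  have no_edge: "\<not> monogenic (gen {x, y})" if "x \<in> A" "y \<in> A" "x \<noteq> y" for x y
    using that A indep_cyclic_graph_iff by metis
  have u: "unique_exponent a i" if "i \<in> I" for i
    using unique_exponent_if_less_index[OF fin] that by (simp add: I_def)
  have finA: "finite A" using A(1) fin by (rule finite_subset)
  have disj: "spow a i \<notin> kernel a" if "i \<in> I" for i
  proof
    assume "spow a i \<in> kernel a"
    then obtain j where j: "index a \<le> j" "spow a j = spow a i"
      by (auto simp: kernel_def)
    then have "j = i"
      using u[OF that] index_ge_1[OF fin] unfolding unique_exponent_def by (metis le_trans)
    then show False using j that by (simp add: I_def)
  qed
  have "A = spow a ` I \<union> (A \<inter> kernel a)"
  proof
    show "A \<subseteq> spow a ` I \<union> (A \<inter> kernel a)"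
    proof
      fix x assume x: "x \<in> A"
      then obtain k where "1 \<le> k" "x = spow a k" using A(1) by (auto simp: gen_singleton)
      then show "x \<in> spow a ` I \<union> (A \<inter> kernel a)"
        using x by (cases "k < index a") (auto simp: I_def kernel_def)
    qed
  qed (auto simp: I_def)
  then have "card A = card (spow a ` I \<union> (A \<inter> kernel a))" by simp
  also have "\<dots> = card (spow a ` I) + card (A \<inter> kernel a)"
    using disj finA by (intro card_Un_disjoint) (auto simp: I_def)
  also have "card (spow a ` I) = card I"
    using unique_exponent_inj_on[OF u] by (rule card_image)
  finally show ?split .
  show "PROP ?anti i j" for i j
  proof (rule ccontr)
    assume ij: "i \<in> I" "j \<in> I" "i dvd j" "i \<noteq> j"
    then have "spow a i \<noteq> spow a j" "i \<le> j"
      using unique_exponent_inj_on[of I, OF u] by (auto simp: inj_on_def I_def intro: dvd_imp_le)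
    then show False
      using no_edge[of "spow a i" "spow a j"] ij monogenic_pair_iff_dvd[OF u u, of i j]
      by (simp add: I_def)
  qed
  show ?kernel
    using no_edge kernel_pair_monogenic[OF fin] finA
    by (auto simp: card_le_Suc0_iff_eq)
  show "PROP ?cop i" for i
  proof
    assume ne: "A \<inter> kernel a \<noteq> {}" and i: "i \<in> I" and cop: "coprime i (period a)"
    from ne obtain j where j: "index a \<le> j" "spow a j \<in> A" "spow a j \<in> kernel a"
      by (auto simp: kernel_def)
    have "spow a j \<in> gen {spow a i}"
      using i cop j(3) by (intro in_gen_if_coprime fin) (auto simp: I_def)
    then have "monogenic (gen {spow a i, spow a j})"
      using monogenic_pair_unique_exponent_iff[OF u[OF i], of j] j(1) i by (simp add: I_def)
    moreover have "spow a i \<noteq> spow a j" using disj[OF i] j(3) by metis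
    ultimately show False
      using no_edge[of "spow a i" "spow a j"] i j(2) by (simp add: I_def)
  qed
qed

lemma independent_upper_half:
  assumes fin: "finite (gen {a})"
  defines "I \<equiv> {i. index a \<le> 2 * i \<and> i < index a}"
  shows "spow a ` I \<subseteq> gen {a}" "indep (spow a ` I) (cyclic_graph_edges (gen {a}))"
    "card (spow a ` I) = index a div 2"
proof -
  have u: "unique_exponent a i" if "i \<in> I" for i
    using unique_exponent_if_less_index[OF fin] that by (auto simp: I_def)
  show "spow a ` I \<subseteq> gen {a}" using u by (auto simp: gen_singleton unique_exponent_def)
  show "indep (spow a ` I) (cyclic_graph_edges (gen {a}))"
    using u by (rule indep_spow_image) (auto simp: I_def)
  have "I = {(index a + 1) div 2..<index a}" by (auto simp: I_def)
  then have "card I = index a - (index a + 1) div 2" by simp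
  also have "\<dots> = index a div 2" by linarith
  finally show "card (spow a ` I) = index a div 2"
    using unique_exponent_inj_on[OF u] by (simp add: card_image)
qed

text \<open>For index \<open>1\<close> the whole semigroup is the group \<open>kernel a\<close>, and the graph is complete.\<close>

lemma independence_number_index_1:
  assumes fin: "finite (gen {a})" and m: "index a = 1"
  shows "independence_number (gen {a}) (cyclic_graph_edges (gen {a})) = 1"
proof -
  let ?E = "cyclic_graph_edges (gen {a})"
  have "independence_number (gen {a}) ?E = enat 1"
  proof (rule independence_number_eq[OF fin, of "{a}"])
    show "{a} \<subseteq> gen {a}" by (rule gen_superset)
    show "indep {a} ?E" by (simp add: indep_def)
    show "card B \<le> 1" if "B \<subseteq> gen {a}" "indep B ?E" for B
      using independent_set_split(1,3)[OF fin that] m by simp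
  qed simp
  then show ?thesis by (simp add: one_enat_def)
qed

lemma independence_number_no_coprime:
  assumes fin: "finite (gen {a})"
    and cop: "\<And>i. index a \<le> 2 * i \<Longrightarrow> i < index a \<Longrightarrow> \<not> coprime i (period a)"
  shows "independence_number (gen {a}) (cyclic_graph_edges (gen {a})) = enat (index a div 2 + 1)"
proof -
  let ?E = "cyclic_graph_edges (gen {a})"
  let ?I = "{i. index a \<le> 2 * i \<and> i < index a}"
  \<comment> \<open>An exponent of a group generator: congruent to \<open>1\<close> modulo the period, and not below the index.\<close>
  define e where "e = index a * period a + 1"
  define g where "g = spow a e"
  have e_ge: "index a \<le> e"
    using period_ge_1[OF fin] by (cases "period a") (auto simp: e_def)
  have e_cong: "[e = 1] (mod period a)"
    unfolding e_def cong_def by (rule mod_mult_self3)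
  have u: "unique_exponent a i" if "i \<in> ?I" for i
    using unique_exponent_if_less_index[OF fin] that by auto
  have g_notin: "g \<notin> gen {spow a i}" if i: "i \<in> ?I" for i
  proof
    assume "g \<in> gen {spow a i}"
    moreover have "1 \<le> i" using u[OF i] by (simp add: unique_exponent_def)
    ultimately have "coprime i (period a)"
      unfolding g_def by (rule coprime_if_generator_in_gen[OF fin _ e_ge e_cong, rotated])
    then show False using cop i by simp
  qed
  define U where "U = spow a ` ?I"
  note upper = independent_upper_half[OF fin, folded U_def]
  have no_edge: "\<not> monogenic (gen {x, g})" if "x \<in> U" for x
  proof -
    obtain i where i: "i \<in> ?I" "x = spow a i" using \<open>x \<in> U\<close> unfolding U_def by blast
    then have "i \<le> e" using e_ge by simp
    then show ?thesis
      using monogenic_pair_unique_exponent_iff[OF u[OF i(1)]] g_notin[OF i(1)]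
      unfolding i(2) g_def by simp
  qed
  have "g \<notin> U"
  proof
    assume "g \<in> U"
    then obtain i where "i \<in> ?I" "g = spow a i" unfolding U_def by blast
    then show False using g_notin[of i] gen_superset[of "{g}"] by simp
  qed
  show ?thesis
  proof (rule independence_number_eq[OF fin, of "insert g U"])
    have "g \<in> gen {a}"
      unfolding g_def using gen_superset[of "{a}"] by (intro spow_in_gen) (auto simp: e_def)
    then show sub: "insert g U \<subseteq> gen {a}" using upper(1) by simp
    have "\<not> monogenic (gen {g, x})" if "x \<in> U" for x
      using no_edge[OF that] by (subst insert_commute)
    then show "indep (insert g U) ?E"
      using upper(2) no_edge
      unfolding indep_cyclic_graph_iff[OF sub] indep_cyclic_graph_iff[OF upper(1)] by blast
    show "card (insert g U) = index a div 2 + 1"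
      using upper(3) \<open>g \<notin> U\<close> finite_subset[OF upper(1) fin] by simp
    show "card B \<le> index a div 2 + 1" if B: "B \<subseteq> gen {a}" "indep B ?E" for B
    proof -
      have "card {i \<in> {1..<index a}. spow a i \<in> B} \<le> index a div 2"
        using independent_set_split(2)[OF fin B] by (rule card_antichain_le) auto
      then show ?thesis using independent_set_split(1,3)[OF fin B] by simp
    qed
  qed
qed

text \<open>
  Containing an element of the group costs at least one of the \<open>index a div 2\<close> exponents, since an
  antichain of that size contains a divisor of \<open>n\<close>, and this divisor is coprime to the period.
\<close>

lemma independence_number_coprime:
  assumes fin: "finite (gen {a})"
    and n: "index a \<le> 2 * n" "n < index a" "coprime n (period a)"
  shows "independence_number (gen {a}) (cyclic_graph_edges (gen {a})) = enat (index a div 2)"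
proof (rule independence_number_eq[OF fin independent_upper_half[OF fin]])
  fix B assume B: "B \<subseteq> gen {a}" "indep B (cyclic_graph_edges (gen {a}))"
  let ?I = "{i \<in> {1..<index a}. spow a i \<in> B}"
  note split = independent_set_split[OF fin B]
  have le: "card ?I \<le> index a div 2"
    using split(2) by (rule card_antichain_le) auto
  show "card B \<le> index a div 2"
  proof (cases "B \<inter> kernel a = {}")
    case True
    then show ?thesis using split(1) le by simp
  next
    case False
    have "card ?I \<noteq> index a div 2"
    proof
      assume "card ?I = index a div 2"
      then have "\<exists>i\<in>?I. i dvd n"
        using split(2) n(1,2) by (intro maximum_antichain_contains_divisor) auto
      then obtain i where "i \<in> ?I" "i dvd n" by blast
      then have "coprime i (period a)" using n(3) by (metis coprime_divisors dvd_refl)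
      then show False using split(4)[OF False \<open>i \<in> ?I\<close>] by simp
    qed
    then show ?thesis using split(1,3) le by simp
  qed
qed

theorem theorem5p1:
  fixes S :: "'a::semigroup_mult set" and a :: 'a
  assumes "S = gen {a}"
  shows
    "(infinite S \<longrightarrow>
        independence_number S (cyclic_graph_edges S) = \<infinity>) \<and>
     (finite S \<and> index a = 1 \<longrightarrow>
        independence_number S (cyclic_graph_edges S) = 1) \<and>
     (finite S \<and> index a > 1 \<and>
      (\<forall>i::nat. \<lceil>real (index a) / 2\<rceil> \<le> int i \<and> i \<le> index a - 1 \<longrightarrow> gcd i (period a) > 1) \<longrightarrow>
        independence_number S (cyclic_graph_edges S) = enat (nat \<lfloor>real (index a) / 2\<rfloor> + 1)) \<and>
     (finite S \<and> index a > 1 \<and>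
      (\<exists>i::nat. \<lceil>real (index a) / 2\<rceil> \<le> int i \<and> i \<le> index a - 1 \<and> gcd i (period a) = 1) \<longrightarrow>
        independence_number S (cyclic_graph_edges S) = enat (nat \<lfloor>real (index a) / 2\<rfloor>))"
proof -
  have half: "nat \<lfloor>real (index a) / 2\<rfloor> = index a div 2"
    using floor_divide_of_nat_eq[of "index a" 2, where ?'a = real] by simp
  have upper: "\<lceil>real (index a) / 2\<rceil> \<le> int i \<longleftrightarrow> index a \<le> 2 * i" for i
    by (simp add: ceiling_le_iff) linarith
  show ?thesis
    unfolding half upper unfolding assms
  proof (intro conjI impI)
    assume *: "finite (gen {a}) \<and> index a > 1 \<and>
      (\<forall>i::nat. index a \<le> 2 * i \<and> i \<le> index a - 1 \<longrightarrow> gcd i (period a) > 1)"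
    have "\<not> coprime i (period a)" if "index a \<le> 2 * i" "i < index a" for i
    proof -
      have "gcd i (period a) > 1" using * that by simp
      then show ?thesis by (auto simp: coprime_iff_gcd_eq_1)
    qed
    then show "independence_number (gen {a}) (cyclic_graph_edges (gen {a})) = enat (index a div 2 + 1)"
      using * by (intro independence_number_no_coprime) auto
  next
    assume *: "finite (gen {a}) \<and> index a > 1 \<and>
      (\<exists>i::nat. index a \<le> 2 * i \<and> i \<le> index a - 1 \<and> gcd i (period a) = 1)"
    then obtain n where "index a \<le> 2 * n" "n < index a" "coprime n (period a)"
      by (auto simp: coprime_iff_gcd_eq_1)
    then show "independence_number (gen {a}) (cyclic_graph_edges (gen {a})) = enat (index a div 2)"
      using * by (intro independence_number_coprime) auto
  qed (auto simp: independence_number_infinite independence_number_index_1)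
qed

end
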